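(* Let $\Omega\subset\mathbb{R}^d$ be bounded, and let $\{f_n\}_{n\ge1}$ and $f$ be probability density functions on $\Omega$ with $f_n\to f$ in Lebesgue measure and $H(f)$ finite. Then $H(f_n)\to H(f)$ if and only if the family $\{f_n\lvert\log f_n\rvert\}_{n\ge1}$ is uniformly integrable.
   Context: The set $\Omega$ is (Lebesgue) measurable and carries Lebesgue measure $\lambda$. A probability density function (pdf) on $\Omega$ is a measurable $f:\Omega\to[0,\infty)$ with $\int_\Omega f\,dx=1$. The differential entropy is $H(f)=-\int_\Omega f\log f\,dx$, with natural logarithm and the convention $0\log0=0$; $f\lvert\log f\rvert$ is likewise $0$ where $f=0$. "$H(f)$ finite" means $f\log f\in L^1(\Omega)$. A family $\{g_n\}$ of integrable functions on the finite measure space $(\Omega,\lambda)$ is uniformly integrable if: (A) $\sup_n\int_\Omega\lvert g_n\rvert\,dx<\infty$; and (B) for every $\varepsilon>0$ there is $M>0$ with $\sup_n\int_{\{\lvert g_n\rvert>M\}}\lvert g_n\rvert\,dx<\varepsilon$.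
   Formalization: "H(f_n) → H(f)" is read as including that every H(f_n) is finite; otherwise the "only if" part fails, since a single f_1 with H(f_1) = −∞ does not affect the limit but makes the family fail condition (A). *)

theory Defs
  imports "HOL-Analysis.Analysis"
begin

definition is_pdf_on :: "'a::euclidean_space set \<Rightarrow> ('a \<Rightarrow> real) \<Rightarrow> bool" where
  "is_pdf_on \<Omega> f \<longleftrightarrow>
     f \<in> borel_measurable (lebesgue_on \<Omega>) \<and>
     (\<forall>x\<in>\<Omega>. 0 \<le> f x) \<and>
     (\<integral>\<^sup>+x. ennreal (f x) \<partial>lebesgue_on \<Omega>) = 1"

text \<open>The convention that \<open>0 * log 0 = 0\<close> holds automatically, whatever the value of \<open>ln 0\<close>.\<close>

definition finite_diff_entropy :: "'a::euclidean_space set \<Rightarrow> ('a \<Rightarrow> real) \<Rightarrow> bool" where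
  "finite_diff_entropy \<Omega> f \<longleftrightarrow> integrable (lebesgue_on \<Omega>) (\<lambda>x. f x * ln (f x))"

text \<open>The Bochner integral of a non-integrable function is \<open>0\<close>, so the following value is
  meaningful only under \<^const>\<open>finite_diff_entropy\<close>.\<close>

definition diff_entropy :: "'a::euclidean_space set \<Rightarrow> ('a \<Rightarrow> real) \<Rightarrow> real" where
  "diff_entropy \<Omega> f = - (LINT x|lebesgue_on \<Omega>. f x * ln (f x))"

definition tendsto_in_measure ::
    "'a measure \<Rightarrow> (nat \<Rightarrow> 'a \<Rightarrow> real) \<Rightarrow> ('a \<Rightarrow> real) \<Rightarrow> bool" where
  "tendsto_in_measure M f g \<longleftrightarrow>
     (\<forall>\<epsilon>>0. (\<lambda>n. emeasure M {x \<in> space M. \<epsilon> < \<bar>f n x - g x\<bar>}) \<longlonglongrightarrow> 0)"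

definition uniformly_integrable :: "'a measure \<Rightarrow> ('i \<Rightarrow> 'a \<Rightarrow> real) \<Rightarrow> bool" where
  "uniformly_integrable M g \<longleftrightarrow>
     (\<forall>i. integrable M (g i)) \<and>
     (SUP i. \<integral>\<^sup>+x. ennreal \<bar>g i x\<bar> \<partial>M) < \<infinity> \<and>
     (\<forall>\<epsilon>::real. 0 < \<epsilon> \<longrightarrow>
        (\<exists>K>0. (SUP i. \<integral>\<^sup>+x\<in>{x \<in> space M. K < \<bar>g i x\<bar>}. ennreal \<bar>g i x\<bar> \<partial>M) < ennreal \<epsilon>))"

end

theory Submission
  imports Defs "HOL-Real_Asymp.Real_Asymp"
begin

text \<open>
  On a finite measure space, let \<open>u n\<close> be integrable functions with a common lower bound. Then their
  absolute values are uniformly integrable iff every \<open>\<epsilon> > 0\<close> admits a \<open>K\<close> for which all the tails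
  \<open>\<integral> max 0 (u n - K)\<close> are at most \<open>\<epsilon>\<close>. If, for an integrable \<open>v\<close>, the truncations \<open>min (u n) K\<close>
  converge in measure to \<open>min v K\<close>, then, being bounded, their integrals converge, so that
  \<open>w = min w K + max 0 (w - K)\<close> translates convergence of \<open>\<integral> u n\<close> to \<open>\<integral> v\<close> into control of the
  tails and back. This applies to \<open>u n = f n ln (f n) \<ge> -1\<close>: although \<open>t ln t\<close> is not uniformly
  continuous at infinity, its truncation \<open>min (t ln t) K\<close> is uniformly continuous on \<open>[0, \<infinity>)\<close>.
\<close>

section \<open>Bounded convergence in measure\<close>

text \<open>Split the space at a small threshold \<open>e\<close> for the difference. Where it is
  exceeded, the difference is still at most \<open>2 * B\<close>, on a set whose measure tends to 0;
  elsewhere it contributes at most \<open>e\<close> times the total measure.\<close>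

lemma (in finite_measure) integral_tendsto_of_bounded_in_measure:
  fixes v :: "nat \<Rightarrow> 'a \<Rightarrow> real"
  assumes meas [measurable]: "\<And>n. v n \<in> borel_measurable M" "w \<in> borel_measurable M"
    and bound: "\<And>n x. x \<in> space M \<Longrightarrow> \<bar>v n x\<bar> \<le> B" "\<And>x. x \<in> space M \<Longrightarrow> \<bar>w x\<bar> \<le> B"
    and conv: "tendsto_in_measure M v w"
  shows "(\<lambda>n. integral\<^sup>L M (v n)) \<longlonglongrightarrow> integral\<^sup>L M w"
proof -
  have int: "integrable M (v n)" "integrable M w" for n
    using bound by (auto intro!: integrable_const_bound[where B = B])
  have "\<forall>\<^sub>F n in sequentially. \<bar>integral\<^sup>L M (v n) - integral\<^sup>L M w\<bar> < r" if "r > 0" for r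
  proof -
    \<comment> \<open>The \<open>+ 1\<close> keeps the denominator positive when the space has
      measure 0.\<close>
    define e where "e = r / (2 * (measure M (space M) + 1))"
    have pos: "measure M (space M) + 1 > 0"
      by (smt (verit) measure_nonneg)
    have e: "e > 0" "e * measure M (space M) \<le> r / 2"
      using \<open>r > 0\<close> pos by (auto simp: e_def field_simps)
    define A where "A n = {x \<in> space M. e < \<bar>v n x - w x\<bar>}" for n
    have A [measurable]: "A n \<in> sets M" for n
      by (simp add: A_def)
    have "(\<lambda>n. emeasure M (A n)) \<longlonglongrightarrow> 0"
      using conv e unfolding tendsto_in_measure_def A_def by blast
    then have "(\<lambda>n. measure M (A n)) \<longlonglongrightarrow> 0"
      by (simp add: emeasure_eq_measure ennreal_tendsto_0_iff)
    then have "(\<lambda>n. 2 * B * measure M (A n)) \<longlonglongrightarrow> 2 * B * 0"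
      by (intro tendsto_intros)
    then have "\<forall>\<^sub>F n in sequentially. 2 * B * measure M (A n) < r / 2"
      using \<open>r > 0\<close> by (intro order_tendstoD(2)) auto
    then show ?thesis
    proof eventually_elim
      case (elim n)
      have "\<bar>integral\<^sup>L M (v n) - integral\<^sup>L M w\<bar> = \<bar>\<integral>x. v n x - w x \<partial>M\<bar>"
        using int by simp
      also have "\<dots> \<le> (\<integral>x. \<bar>v n x - w x\<bar> \<partial>M)"
        by (rule integral_abs_bound)
      also have "\<dots> \<le> (\<integral>x. e + 2 * B * indicator (A n) x \<partial>M)"
      proof (rule integral_mono)
        fix x assume x: "x \<in> space M"
        show "\<bar>v n x - w x\<bar> \<le> e + 2 * B * indicator (A n) x"
          using bound(1)[OF x, of n] bound(2)[OF x] x e by (auto simp: A_def indicator_def)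
      qed (use int in \<open>auto simp: emeasure_eq_measure\<close>)
      also have "\<dots> = e * measure M (space M) + 2 * B * measure M (A n)"
        by (simp add: emeasure_eq_measure)
      finally show ?case using elim e by simp
    qed
  qed
  then show ?thesis
    by (auto simp: tendsto_iff dist_real_def)
qed

section \<open>Tails above a level and uniform integrability\<close>

lemma integrable_excess:
  fixes u :: "'a \<Rightarrow> real"
  assumes "finite_measure M" "integrable M u"
  shows "integrable M (\<lambda>x. max 0 (u x - K))"
  using assms by (intro integrable_max Bochner_Integration.integrable_diff finite_measure.integrable_const) auto

text \<open>At each point the excess vanishes once \<open>k\<close> passes the value of
  \<open>u\<close>, and it never exceeds the absolute value of \<open>u\<close>, so dominated
  convergence applies.\<close>

lemma integral_excess_tendsto_0:
  fixes u :: "'a \<Rightarrow> real"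
  assumes "integrable M u"
  shows "(\<lambda>k. \<integral>x. max 0 (u x - real k) \<partial>M) \<longlonglongrightarrow> 0"
proof -
  have [measurable]: "u \<in> borel_measurable M"
    using assms by auto
  have "(\<lambda>k. \<integral>x. max 0 (u x - real k) \<partial>M) \<longlonglongrightarrow> (\<integral>x. 0 \<partial>M)"
  proof (rule integral_dominated_convergence[where w = "\<lambda>x. \<bar>u x\<bar>"])
    show "AE x in M. (\<lambda>k. max 0 (u x - real k)) \<longlonglongrightarrow> 0"
    proof (rule AE_I2)
      fix x
      obtain N where N: "u x \<le> real N"
        using real_arch_simple by blast
      have "\<forall>\<^sub>F k in sequentially. max 0 (u x - real k) = 0"
        using eventually_ge_at_top[of N] by eventually_elim (use N in auto)
      then show "(\<lambda>k. max 0 (u x - real k)) \<longlonglongrightarrow> 0"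
        by (rule tendsto_eventually)
    qed
    show "integrable M (\<lambda>x. \<bar>u x\<bar>)"
      using assms by (rule integrable_abs)
    show "AE x in M. norm (max 0 (u x - real k)) \<le> \<bar>u x\<bar>" for k
      by (rule AE_I2) simp
  qed measurable
  then show ?thesis by simp
qed

text \<open>The lower bound makes large absolute values come from large positive values only.
  Integrals of \<open>u n\<close> over such sets are then comparable with the excess over a level,
  at the cost of doubling the level and the integral.\<close>

lemma uniformly_integrable_abs_iff_excess:
  fixes u :: "'i \<Rightarrow> 'a \<Rightarrow> real"
  assumes fin: "finite_measure M"
    and meas [measurable]: "\<And>n. u n \<in> borel_measurable M"
    and lower: "\<And>n x. x \<in> space M \<Longrightarrow> - c \<le> u n x"
  shows "uniformly_integrable M (\<lambda>n x. \<bar>u n x\<bar>) \<longleftrightarrow>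
    (\<forall>n. integrable M (u n)) \<and> (\<forall>e>0. \<exists>K. \<forall>n. (\<integral>x. max 0 (u n x - K) \<partial>M) \<le> e)"
    (is "?L \<longleftrightarrow> ?R")
proof
  interpret finite_measure M by (rule fin)
  have excess: "(\<integral>\<^sup>+x. ennreal (max 0 (u n x - K)) \<partial>M) = ennreal (\<integral>x. max 0 (u n x - K) \<partial>M)"
    if "integrable M (u n)" for n K
    using that by (intro nn_integral_eq_integral integrable_excess fin) auto
  {
    assume L: ?L
    have int: "integrable M (u n)" for n
      using L by (auto simp: uniformly_integrable_def integrable_abs_iff)
    moreover have "\<exists>K. \<forall>n. (\<integral>x. max 0 (u n x - K) \<partial>M) \<le> e" if e: "e > 0" for e
    proof -
      \<comment> \<open>The doubled bars arise because \<open>uniformly_integrable\<close> takes the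
        absolute value of a family that consists of absolute values already.\<close>
      define I where
        "I K n = (\<integral>\<^sup>+x\<in>{x \<in> space M. K < \<bar>\<bar>u n x\<bar>\<bar>}. ennreal \<bar>\<bar>u n x\<bar>\<bar> \<partial>M)" for K n
      obtain K where K: "K > 0" "(SUP n. I K n) < ennreal e"
        using L e unfolding uniformly_integrable_def I_def by blast
      have "(\<integral>x. max 0 (u n x - K) \<partial>M) \<le> e" for n
      proof -
        have "ennreal (\<integral>x. max 0 (u n x - K) \<partial>M) \<le> I K n"
          unfolding excess[OF int, symmetric] I_def
          using K by (intro nn_integral_mono) (auto simp: indicator_def intro!: ennreal_leI)
        also have "I K n \<le> (SUP n. I K n)"
          by (rule SUP_upper) simp
        also have "\<dots> \<le> ennreal e" using K by simp
        finally show ?thesis using e by simp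
      qed
      then show ?thesis by blast
    qed
    ultimately show ?R by blast
  }
  {
    assume R: ?R
    have int: "integrable M (u n)" for n using R by blast
    have ex: "\<exists>K>0. c \<le> K \<and> (\<forall>n. (\<integral>x. max 0 (u n x - K) \<partial>M) \<le> e)"
      if e: "e > 0" for e
    proof -
      obtain K where K: "\<And>n. (\<integral>x. max 0 (u n x - K) \<partial>M) \<le> e"
        using R e by blast
      \<comment> \<open>Raising the level only shrinks the excess, so it may be taken positive and
        at least \<open>c\<close>.\<close>
      define K' where "K' = max (max K c) 1"
      have "(\<integral>x. max 0 (u n x - K') \<partial>M) \<le> e" for n
      proof -
        have "(\<integral>x. max 0 (u n x - K') \<partial>M) \<le> (\<integral>x. max 0 (u n x - K) \<partial>M)"
          by (intro integral_mono integrable_excess fin int) (auto simp: K'_def)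
        then show ?thesis using K[of n] by linarith
      qed
      moreover have "K' > 0" "c \<le> K'" by (auto simp: K'_def)
      ultimately show ?thesis by blast
    qed
    have "(SUP n. \<integral>\<^sup>+x. ennreal \<bar>\<bar>u n x\<bar>\<bar> \<partial>M) < \<infinity>"
    proof -
      obtain K where K: "K > 0" "c \<le> K" "\<And>n. (\<integral>x. max 0 (u n x - K) \<partial>M) \<le> 1"
        using ex[of 1] by auto
      have "(\<integral>\<^sup>+x. ennreal \<bar>\<bar>u n x\<bar>\<bar> \<partial>M) \<le> ennreal K * emeasure M (space M) + 1" for n
      proof -
        have "(\<integral>\<^sup>+x. ennreal \<bar>\<bar>u n x\<bar>\<bar> \<partial>M) \<le> (\<integral>\<^sup>+x. ennreal K + ennreal (max 0 (u n x - K)) \<partial>M)"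
        proof (rule nn_integral_mono)
          fix x assume "x \<in> space M"
          \<comment> \<open>If \<open>u n x\<close> is negative, its absolute value is at most
            \<open>c\<close>, hence at most \<open>K\<close>.\<close>
          then have "\<bar>\<bar>u n x\<bar>\<bar> \<le> K + max 0 (u n x - K)"
            using lower[of x n] K by auto
          then show "ennreal \<bar>\<bar>u n x\<bar>\<bar> \<le> ennreal K + ennreal (max 0 (u n x - K))"
            using K by (simp add: ennreal_leI flip: ennreal_plus)
        qed
        also have "\<dots> = ennreal K * emeasure M (space M) + ennreal (\<integral>x. max 0 (u n x - K) \<partial>M)"
          by (simp add: nn_integral_add excess[OF int])
        also have "\<dots> \<le> ennreal K * emeasure M (space M) + 1"
          using K(3)[of n] by (intro add_left_mono) simp
        finally show ?thesis .
      qed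
      then have "(SUP n. \<integral>\<^sup>+x. ennreal \<bar>\<bar>u n x\<bar>\<bar> \<partial>M) \<le> ennreal K * emeasure M (space M) + 1"
        by (intro SUP_least)
      also have "\<dots> < \<infinity>"
        by (simp add: emeasure_eq_measure ennreal_mult_less_top)
      finally show ?thesis .
    qed
    moreover have "\<exists>K>0. (SUP n. \<integral>\<^sup>+x\<in>{x \<in> space M. K < \<bar>\<bar>u n x\<bar>\<bar>}. ennreal \<bar>\<bar>u n x\<bar>\<bar> \<partial>M) < ennreal e"
      if e: "e > 0" for e
    proof -
      \<comment> \<open>The quarter doubles to \<open>e / 2\<close> below; the remaining slack makes
        the supremum strictly less than \<open>e\<close>.\<close>
      obtain K where K: "K > 0" "c \<le> K" "\<And>n. (\<integral>x. max 0 (u n x - K) \<partial>M) \<le> e / 4"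
        using ex[of "e / 4"] e by auto
      have "(\<integral>\<^sup>+x\<in>{x \<in> space M. 2 * K < \<bar>\<bar>u n x\<bar>\<bar>}. ennreal \<bar>\<bar>u n x\<bar>\<bar> \<partial>M) \<le> ennreal (e / 2)" for n
      proof -
        have "(\<integral>\<^sup>+x\<in>{x \<in> space M. 2 * K < \<bar>\<bar>u n x\<bar>\<bar>}. ennreal \<bar>\<bar>u n x\<bar>\<bar> \<partial>M)
          \<le> (\<integral>\<^sup>+x. 2 * ennreal (max 0 (u n x - K)) \<partial>M)"
        proof (rule nn_integral_mono)
          fix x assume x: "x \<in> space M"
          \<comment> \<open>Negative values have absolute value at most \<open>c \<le> K\<close>, so
            here \<open>u n x > 2 * K\<close>, which means that \<open>u n x - K\<close> is more
            than half of \<open>u n x\<close>.\<close>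
          have "\<bar>u n x\<bar> \<le> 2 * max 0 (u n x - K)" if "2 * K < \<bar>u n x\<bar>"
            using lower[OF x, of n] K that by auto
          then show "ennreal \<bar>\<bar>u n x\<bar>\<bar> * indicator {x \<in> space M. 2 * K < \<bar>\<bar>u n x\<bar>\<bar>} x
              \<le> 2 * ennreal (max 0 (u n x - K))"
            by (auto simp: indicator_def ennreal_leI simp flip: ennreal_numeral ennreal_mult)
        qed
        also have "\<dots> = 2 * ennreal (\<integral>x. max 0 (u n x - K) \<partial>M)"
          by (simp add: nn_integral_cmult excess[OF int])
        also have "\<dots> = ennreal (2 * (\<integral>x. max 0 (u n x - K) \<partial>M))"
          by (simp add: ennreal_mult)
        also have "\<dots> \<le> ennreal (e / 2)"
          using K(3)[of n] by (intro ennreal_leI) simp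
        finally show ?thesis .
      qed
      then have "(SUP n. \<integral>\<^sup>+x\<in>{x \<in> space M. 2 * K < \<bar>\<bar>u n x\<bar>\<bar>}. ennreal \<bar>\<bar>u n x\<bar>\<bar> \<partial>M) \<le> ennreal (e / 2)"
        by (intro SUP_least)
      also have "\<dots> < ennreal e"
        using e by (intro ennreal_lessI) auto
      finally show ?thesis
        using K by (intro exI[of _ "2 * K"]) simp
    qed
    ultimately show ?L
      using int by (auto simp: uniformly_integrable_def)
  }
qed

section \<open>Convergence of integrals as control of tails\<close>

text \<open>Truncated integrals always converge here, so only the tails matter. Integrability stands
  beside the limit because the Bochner integral of a non-integrable function is 0, and the limit
  alone would not detect it.\<close>

lemma integral_tendsto_iff_uniformly_integrable:
  fixes u :: "nat \<Rightarrow> 'a \<Rightarrow> real"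
  assumes fin: "finite_measure M"
    and meas [measurable]: "\<And>n. u n \<in> borel_measurable M"
    and int_u: "integrable M v"
    and lower: "\<And>n x. x \<in> space M \<Longrightarrow> - c \<le> u n x" "\<And>x. x \<in> space M \<Longrightarrow> - c \<le> v x"
    and conv: "\<And>K. tendsto_in_measure M (\<lambda>n x. min (u n x) K) (\<lambda>x. min (v x) K)"
  shows "(\<forall>n. integrable M (u n)) \<and> (\<lambda>n. integral\<^sup>L M (u n)) \<longlonglongrightarrow> integral\<^sup>L M v
    \<longleftrightarrow> uniformly_integrable M (\<lambda>n x. \<bar>u n x\<bar>)" (is "_ \<longleftrightarrow> ?U")
proof -
  interpret finite_measure M by (rule fin)
  have [measurable]: "v \<in> borel_measurable M" using int_u by auto
  have trunc: "(\<lambda>n. \<integral>x. min (u n x) K \<partial>M) \<longlonglongrightarrow> (\<integral>x. min (v x) K \<partial>M)" for K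
  proof (rule integral_tendsto_of_bounded_in_measure[OF _ _ _ _ conv])
    show "\<bar>min (u n x) K\<bar> \<le> max \<bar>c\<bar> \<bar>K\<bar>" if "x \<in> space M" for n x
      using lower(1)[OF that, of n] by auto
    show "\<bar>min (v x) K\<bar> \<le> max \<bar>c\<bar> \<bar>K\<bar>" if "x \<in> space M" for x
      using lower(2)[OF that] by auto
  qed auto
  have split: "integral\<^sup>L M w = (\<integral>x. min (w x) K \<partial>M) + (\<integral>x. max 0 (w x - K) \<partial>M)"
    if "integrable M w" for w :: "'a \<Rightarrow> real" and K
  proof -
    have "integrable M (\<lambda>x. min (w x) K)"
      using that by (intro integrable_min) auto
    then have "(\<integral>x. min (w x) K \<partial>M) + (\<integral>x. max 0 (w x - K) \<partial>M) = (\<integral>x. min (w x) K + max 0 (w x - K) \<partial>M)"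
      using integrable_excess[OF fin that] by simp
    also have "\<dots> = integral\<^sup>L M w"
      by (intro Bochner_Integration.integral_cong) auto
    finally show ?thesis by simp
  qed
  have anti: "(\<integral>x. max 0 (w x - K') \<partial>M) \<le> (\<integral>x. max 0 (w x - K) \<partial>M)"
    if "integrable M w" "K \<le> K'" for w :: "'a \<Rightarrow> real" and K K'
    using that by (intro integral_mono integrable_excess fin) auto
  have small: "\<exists>k. (\<integral>x. max 0 (w x - real k) \<partial>M) < e"
    if "integrable M w" "e > 0" for w :: "'a \<Rightarrow> real" and e
    using order_tendstoD(2)[OF integral_excess_tendsto_0[OF that(1)] that(2)]
    by (auto dest: eventually_happens)
  have ui: "?U \<longleftrightarrow> (\<forall>n. integrable M (u n)) \<and> (\<forall>e>0. \<exists>K. \<forall>n. (\<integral>x. max 0 (u n x - K) \<partial>M) \<le> e)"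
    using fin meas lower(1) by (rule uniformly_integrable_abs_iff_excess)
  show ?thesis
    unfolding ui
  proof (rule conj_cong[OF refl], rule iffI, intro allI impI)
    fix e :: real
    assume int: "\<forall>n. integrable M (u n)" and e: "e > 0"
      and lim: "(\<lambda>n. integral\<^sup>L M (u n)) \<longlonglongrightarrow> integral\<^sup>L M v"
    \<comment> \<open>Subtracting the truncated integrals from the full ones leaves the tails at
      level \<open>k\<close>. These converge to the tail of \<open>v\<close>, which is below
      \<open>e\<close>, so they are eventually below \<open>e\<close> too.\<close>
    obtain k where k: "(\<integral>x. max 0 (v x - real k) \<partial>M) < e"
      using small[OF int_u e] by blast
    have "(\<lambda>n. integral\<^sup>L M (u n) - (\<integral>x. min (u n x) (real k) \<partial>M))
      \<longlonglongrightarrow> integral\<^sup>L M v - (\<integral>x. min (v x) (real k) \<partial>M)"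
      by (intro tendsto_diff lim trunc)
    then have "(\<lambda>n. \<integral>x. max 0 (u n x - real k) \<partial>M) \<longlonglongrightarrow> (\<integral>x. max 0 (v x - real k) \<partial>M)"
      using split[OF int_u, of "real k"] split[OF int[rule_format], of _ "real k"] by simp
    then have "\<forall>\<^sub>F n in sequentially. (\<integral>x. max 0 (u n x - real k) \<partial>M) < e"
      using k by (rule order_tendstoD(2))
    then obtain N where N: "\<And>n. n \<ge> N \<Longrightarrow> (\<integral>x. max 0 (u n x - real k) \<partial>M) < e"
      by (auto simp: eventually_sequentially)
    \<comment> \<open>The finitely many indices below \<open>N\<close> get levels of their own; the
      maximum of all levels then serves every \<open>n\<close>.\<close>
    obtain j where j: "\<And>n. (\<integral>x. max 0 (u n x - real (j n)) \<partial>M) < e"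
      using small[OF int[rule_format] e] by metis
    define K where "K = Max (insert k (j ` {..<N}))"
    have "(\<integral>x. max 0 (u n x - real K) \<partial>M) \<le> e" for n
    proof (cases "n < N")
      case True
      then have "j n \<le> K" by (auto simp: K_def)
      then show ?thesis
        using anti[of "u n" "real (j n)" "real K"] int j[of n] by force
    next
      case False
      have "k \<le> K" by (auto simp: K_def)
      then show ?thesis
        using anti[of "u n" "real k" "real K"] int N[of n] False by force
    qed
    then show "\<exists>K. \<forall>n. (\<integral>x. max 0 (u n x - K) \<partial>M) \<le> e" by blast
  next
    assume int: "\<forall>n. integrable M (u n)"
      and tails: "\<forall>e>0. \<exists>K. \<forall>n. (\<integral>x. max 0 (u n x - K) \<partial>M) \<le> e"
    show "(\<lambda>n. integral\<^sup>L M (u n)) \<longlonglongrightarrow> integral\<^sup>L M v"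
    proof (rule tendstoI)
      fix e :: real assume e: "e > 0"
      obtain K\<^sub>0 where K\<^sub>0: "\<And>n. (\<integral>x. max 0 (u n x - K\<^sub>0) \<partial>M) \<le> e / 3"
        using tails e by (meson divide_pos_pos zero_less_numeral)
      obtain k where k: "(\<integral>x. max 0 (v x - real k) \<partial>M) < e / 3"
        using small[OF int_u, of "e / 3"] e by auto
      define K where "K = max K\<^sub>0 (real k)"
      have Ku: "(\<integral>x. max 0 (u n x - K) \<partial>M) \<le> e / 3" for n
        using anti[of "u n" K\<^sub>0 K] int K\<^sub>0[of n] by (force simp: K_def)
      have Kv: "(\<integral>x. max 0 (v x - K) \<partial>M) < e / 3"
        using anti[of v "real k" K] int_u k by (force simp: K_def)
      \<comment> \<open>Both tails lie between 0 and \<open>e / 3\<close>, so they differ by at most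
        \<open>e / 3\<close>; the truncated integrals add less than \<open>e / 3\<close>.\<close>
      have nonneg: "(\<integral>x. max 0 (w x - K) \<partial>M) \<ge> 0" for w :: "'a \<Rightarrow> real"
        by (intro integral_nonneg_AE) auto
      have "\<forall>\<^sub>F n in sequentially. dist (\<integral>x. min (u n x) K \<partial>M) (\<integral>x. min (v x) K \<partial>M) < e / 3"
        using trunc e by (intro tendstoD) auto
      then show "\<forall>\<^sub>F n in sequentially. dist (integral\<^sup>L M (u n)) (integral\<^sup>L M v) < e"
      proof eventually_elim
        case (elim n)
        then show ?case
          using Ku[of n] Kv nonneg[of "u n"] nonneg[of v]
            split[OF int[rule_format, of n], of K] split[OF int_u, of K]
          unfolding dist_real_def by linarith
      qed
    qed
  qed
qed

section \<open>Truncations of t ln t\<close>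

text \<open>By the contrapositive of uniform continuity, values of \<open>\<phi>\<close> that are
  far apart force arguments at least \<open>d\<close> apart, uniformly over the space.\<close>

lemma tendsto_in_measure_uniformly_continuous:
  assumes "uniformly_continuous_on S \<phi>"
    and "\<And>n. f n \<in> borel_measurable M" "g \<in> borel_measurable M"
    and "\<And>n x. x \<in> space M \<Longrightarrow> f n x \<in> S" "\<And>x. x \<in> space M \<Longrightarrow> g x \<in> S"
    and "tendsto_in_measure M f g"
  shows "tendsto_in_measure M (\<lambda>n x. \<phi> (f n x)) (\<lambda>x. \<phi> (g x))"
  unfolding tendsto_in_measure_def
proof (intro allI impI)
  note [measurable] = assms(2,3)
  fix e :: real assume "e > 0"
  then obtain d where d: "d > 0" "\<And>s t. s \<in> S \<Longrightarrow> t \<in> S \<Longrightarrow> \<bar>s - t\<bar> < d \<Longrightarrow> \<bar>\<phi> s - \<phi> t\<bar> < e"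
    using assms(1) unfolding uniformly_continuous_on_def dist_real_def by metis
  \<comment> \<open>Halving \<open>d\<close> turns "at least \<open>d\<close>" into the strict
    inequality in the definition of convergence in measure.\<close>
  have lim: "(\<lambda>n. emeasure M {x \<in> space M. d / 2 < \<bar>f n x - g x\<bar>}) \<longlonglongrightarrow> 0"
    using assms(6) d(1) unfolding tendsto_in_measure_def by (meson half_gt_zero)
  have "{x \<in> space M. e < \<bar>\<phi> (f n x) - \<phi> (g x)\<bar>} \<subseteq> {x \<in> space M. d / 2 < \<bar>f n x - g x\<bar>}" for n
    using assms(4)[of _ n] assms(5) d by force
  then have "emeasure M {x \<in> space M. e < \<bar>\<phi> (f n x) - \<phi> (g x)\<bar>}
      \<le> emeasure M {x \<in> space M. d / 2 < \<bar>f n x - g x\<bar>}" for n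
    by (intro emeasure_mono) auto
  then show "(\<lambda>n. emeasure M {x \<in> space M. e < \<bar>\<phi> (f n x) - \<phi> (g x)\<bar>}) \<longlonglongrightarrow> 0"
    by (intro tendsto_sandwich[OF always_eventually always_eventually tendsto_const lim] allI zero_le)
qed

lemma continuous_on_times_ln: "continuous_on {0..} (\<lambda>t::real. t * ln t)"
proof -
  have "((\<lambda>t::real. t * ln t) \<longlongrightarrow> 0) (at_right 0)"
    by real_asymp
  \<comment> \<open>Only the point 0 is delicate: there the function has value 0, whatever
    \<open>ln 0\<close> is, and this agrees with its right-hand limit.\<close>
  moreover have "at (0::real) within {0..} = at_right 0"
    by (rule at_within_nhd[of _ "{-1<..<1}"]) auto
  ultimately have "continuous (at t within {0..}) (\<lambda>t::real. t * ln t)" if "t \<ge> 0" for t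
    using that by (cases "t = 0") (auto simp: continuous_within intro!: tendsto_intros)
  then show ?thesis
    by (simp add: continuous_on_eq_continuous_within)
qed

text \<open>The inequality \<open>ln s \<le> s - 1\<close> at \<open>s = 1 / t\<close> gives
  \<open>t * ln t \<ge> t - 1\<close>.\<close>

lemma times_ln_ge: "- 1 \<le> t * ln t" if "0 \<le> t" for t :: real
proof (cases "t = 0")
  case False
  then have "- ln t \<le> 1 / t - 1"
    using that ln_le_minus_one[of "1 / t"] by (simp add: ln_div)
  then have "t * (- ln t) \<le> t * (1 / t - 1)"
    using that by (rule mult_left_mono)
  also have "t * (1 / t - 1) = 1 - t"
    using False by (simp add: right_diff_distrib)
  finally show ?thesis
    using that by linarith
qed simp

text \<open>The truncation is constant beyond some \<open>R\<close>, and continuous functions on a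
  compact interval are uniformly continuous.\<close>

lemma uniformly_continuous_on_trunc_times_ln:
  "uniformly_continuous_on {0..} (\<lambda>t::real. min (t * ln t) K)"
proof -
  \<comment> \<open>Past this point \<open>t \<ge> 1\<close> and
    \<open>ln t \<ge> \<bar>K\<bar>\<close>, so the product has reached \<open>K\<close>.\<close>
  define R where "R = exp \<bar>K\<bar>"
  have R: "min (t * ln t) K = K" if "t \<ge> R" for t
  proof -
    have "t \<ge> 1" "ln t \<ge> \<bar>K\<bar>"
      using that one_le_exp_iff[of "\<bar>K\<bar>"] ln_ge_iff[of t "\<bar>K\<bar>"] exp_gt_zero[of "\<bar>K\<bar>"]
      by (auto simp: R_def simp del: one_le_exp_iff exp_gt_zero)
    then have "1 * \<bar>K\<bar> \<le> t * ln t"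
      by (intro mult_mono) auto
    then show ?thesis by simp
  qed
  have "uniformly_continuous_on {0..R + 1} (\<lambda>t::real. min (t * ln t) K)"
    by (intro compact_uniformly_continuous continuous_on_min continuous_on_const
        continuous_on_subset[OF continuous_on_times_ln]) auto
  then show ?thesis
    unfolding uniformly_continuous_on_def
  proof (intro allI impI)
    fix e :: real
    assume uc: "\<forall>e>0. \<exists>d>0. \<forall>x\<in>{0..R + 1}. \<forall>x'\<in>{0..R + 1}. dist x' x < d \<longrightarrow>
        dist (min (x' * ln x') K) (min (x * ln x) K) < e" and e: "e > 0"
    then obtain d where d: "d > 0" "\<And>x x'. x \<in> {0..R + 1} \<Longrightarrow> x' \<in> {0..R + 1} \<Longrightarrow> dist x' x < d \<Longrightarrow>
        dist (min (x' * ln x') K) (min (x * ln x) K) < e"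
      by meson
    \<comment> \<open>With distances below 1, two points either both lie beyond \<open>R\<close> or
      both lie in \<open>{0..R + 1}\<close>; hence the overlap of length 1 and the cap on
      \<open>d\<close>.\<close>
    have "dist (min (x' * ln x') K) (min (x * ln x) K) < e"
      if "x \<ge> 0" "x' \<ge> 0" "dist x' x < min d 1" for x x'
    proof (cases "x \<ge> R \<and> x' \<ge> R")
      case True
      then show ?thesis using R e by simp
    next
      case False
      then show ?thesis using that d(2)[of x x'] by (auto simp: dist_real_def)
    qed
    then show "\<exists>d>0. \<forall>x\<in>{0..}. \<forall>x'\<in>{0..}. dist x' x < d \<longrightarrow>
        dist (min (x' * ln x') K) (min (x * ln x) K) < e"
      using d(1) by (intro exI[of _ "min d 1"]) auto
  qed
qed

text \<open>This serves to move the absolute value inside \<open>f n x * ln (f n x)\<close>, which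
  is legitimate only where \<open>f n\<close> is nonnegative, hence on the space itself.\<close>

lemma uniformly_integrable_cong:
  assumes "\<And>i x. x \<in> space M \<Longrightarrow> u i x = w i x"
  shows "uniformly_integrable M u \<longleftrightarrow> uniformly_integrable M w"
proof -
  have "integrable M (u i) \<longleftrightarrow> integrable M (w i)" for i
    by (intro Bochner_Integration.integrable_cong) (auto simp: assms)
  moreover have "(\<integral>\<^sup>+x. ennreal \<bar>u i x\<bar> \<partial>M) = (\<integral>\<^sup>+x. ennreal \<bar>w i x\<bar> \<partial>M)" for i
    by (intro nn_integral_cong) (auto simp: assms)
  moreover have "(\<integral>\<^sup>+x\<in>{x \<in> space M. K < \<bar>u i x\<bar>}. ennreal \<bar>u i x\<bar> \<partial>M)
      = (\<integral>\<^sup>+x\<in>{x \<in> space M. K < \<bar>w i x\<bar>}. ennreal \<bar>w i x\<bar> \<partial>M)" for K i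
    by (intro nn_integral_cong) (auto simp: assms indicator_def)
  ultimately show ?thesis
    by (simp add: uniformly_integrable_def)
qed

section \<open>Application to differential entropy\<close>

theorem theorem7:
  fixes \<Omega> :: "'a::euclidean_space set"
    and f :: "nat \<Rightarrow> 'a \<Rightarrow> real"
    and g :: "'a \<Rightarrow> real"
  assumes "\<Omega> \<in> sets lebesgue"
    and "bounded \<Omega>"
    and "\<And>n. is_pdf_on \<Omega> (f n)"
    and "is_pdf_on \<Omega> g"
    and "tendsto_in_measure (lebesgue_on \<Omega>) f g"
    and "finite_diff_entropy \<Omega> g"
  shows "((\<forall>n. finite_diff_entropy \<Omega> (f n)) \<and>
          (\<lambda>n. diff_entropy \<Omega> (f n)) \<longlonglongrightarrow> diff_entropy \<Omega> g)
     \<longleftrightarrow> uniformly_integrable (lebesgue_on \<Omega>) (\<lambda>n x. f n x * \<bar>ln (f n x)\<bar>)"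
proof -
  let ?M = "lebesgue_on \<Omega>"
  \<comment> \<open>Boundedness enters here, to make the measure finite.\<close>
  have "\<Omega> \<in> lmeasurable"
    using assms(1,2) by (rule bounded_set_imp_lmeasurable[rotated])
  then have fin: "finite_measure ?M"
    by (rule finite_measure_lebesgue_on)
  have meas [measurable]: "f n \<in> borel_measurable ?M" "g \<in> borel_measurable ?M" for n
    using assms(3,4) by (auto simp: is_pdf_on_def)
  have nonneg: "f n x \<ge> 0" "g x \<ge> 0" if "x \<in> space ?M" for n x
    using assms(3,4) that by (auto simp: is_pdf_on_def)
  have "(\<forall>n. integrable ?M (\<lambda>x. f n x * ln (f n x))) \<and>
      (\<lambda>n. LINT x|?M. f n x * ln (f n x)) \<longlonglongrightarrow> (LINT x|?M. g x * ln (g x))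
    \<longleftrightarrow> uniformly_integrable ?M (\<lambda>n x. \<bar>f n x * ln (f n x)\<bar>)"
  \<comment> \<open>The lower bound \<open>- 1\<close> from \<open>times_ln_ge\<close> dictates
    \<open>c = 1\<close>.\<close>
  proof (rule integral_tendsto_iff_uniformly_integrable[OF fin, where c = 1])
    show "tendsto_in_measure ?M (\<lambda>n x. min (f n x * ln (f n x)) K) (\<lambda>x. min (g x * ln (g x)) K)" for K
      using nonneg assms(5)
      by (intro tendsto_in_measure_uniformly_continuous[OF uniformly_continuous_on_trunc_times_ln]) auto
  qed (use nonneg assms(6) in \<open>auto simp: finite_diff_entropy_def times_ln_ge\<close>)
  moreover have "uniformly_integrable ?M (\<lambda>n x. \<bar>f n x * ln (f n x)\<bar>)
      \<longleftrightarrow> uniformly_integrable ?M (\<lambda>n x. f n x * \<bar>ln (f n x)\<bar>)"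
    by (intro uniformly_integrable_cong) (simp add: abs_mult nonneg del: space_lebesgue_on)
  ultimately show ?thesis
    by (simp add: finite_diff_entropy_def diff_entropy_def tendsto_minus_cancel_left)
qed

end
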